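(* Let $\mathbb{K}$ be a field, let $k\ge 1$ be an integer, let $\rho:\mathbb{N}^{+}\to\mathbb{K}$ be any function, and let $f(x)\in\mathbb{K}[[x]]$ satisfy $$1+\sum_{n\ge 1}\Big(\sum_{T\in T_k(n)}\prod_{h\in\mathcal{H}(T)}\rho(h)\Big)x^n=f(x).$$ Then for every $n\ge 1$ with $[x^{n-1}]f(x)^k\neq 0$, $$\rho(n)=\frac{[x^n]f(x)}{[x^{n-1}]f(x)^k}.$$
   Context: A $k$-ary tree is an ordered rooted unlabeled tree in which every vertex has exactly $k$ subtrees in linear order, where a subtree is allowed to be empty. $T_k(n)$ denotes the set of $k$-ary trees with $n$ vertices. For a tree $T$ and a vertex $u$, the hook length $h_u$ is the number of descendants of $u$ in $T$, counting $u$ itself; $\mathcal{H}(T)$ is the multiset $\{h_u: u\in T\}$, so $\prod_{h\in\mathcal{H}(T)}\rho(h)=\prod_{u\in T}\rho(h_u)$. $[x^n]g(x)$ denotes the coefficient of $x^n$ in the formal power series $g(x)$. *)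

theory Defs
  imports
    "HOL-Library.Multiset"
    "HOL-Library.Sublist"
    "HOL-Computational_Algebra.Formal_Power_Series"
begin

text \<open>
  \<open>Empty\<close> stands for an empty subtree, and the list carried by \<open>Node\<close> is the sequence of
  (possibly empty) subtrees of the root.  Only \<open>Node\<close>s count as vertices.
\<close>

datatype otree = Empty | Node "otree list"

inductive is_kary :: "nat \<Rightarrow> otree \<Rightarrow> bool" for k :: nat where
  Empty: "is_kary k Empty"
| Node: "length ts = k \<Longrightarrow> (\<forall>t \<in> set ts. is_kary k t) \<Longrightarrow> is_kary k (Node ts)"

text \<open>
  A vertex is identified with its address: the list of child indices (counted from 0) on the
  path from the root to it.  A vertex \<open>v\<close> is thus a descendant of \<open>u\<close> (possibly \<open>u\<close> itself)
  iff \<open>u\<close> is a prefix of \<open>v\<close>.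
\<close>

fun is_vertex :: "otree \<Rightarrow> nat list \<Rightarrow> bool" where
  "is_vertex Empty p = False"
| "is_vertex (Node ts) [] = True"
| "is_vertex (Node ts) (i # p) = (i < length ts \<and> is_vertex (ts ! i) p)"

definition vertices :: "otree \<Rightarrow> nat list set" where
  "vertices T = {p. is_vertex T p}"

definition kary_trees :: "nat \<Rightarrow> nat \<Rightarrow> otree set" where
  "kary_trees k n = {T. is_kary k T \<and> card (vertices T) = n}"

definition hook_length :: "otree \<Rightarrow> nat list \<Rightarrow> nat" where
  "hook_length T u = card {v \<in> vertices T. prefix u v}"

definition hooks :: "otree \<Rightarrow> nat multiset" where
  "hooks T = image_mset (hook_length T) (mset_set (vertices T))"

text \<open>
  Finiteness of the vertex sets and of \<open>kary_trees k n\<close>, so that \<open>card\<close>, \<open>mset_set\<close> and sums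
  over these sets have their intended meaning.
\<close>

lemma vertices_Empty: "vertices Empty = {}"
  by (simp add: vertices_def)

lemma vertices_Node:
  "vertices (Node ts) = insert [] (\<Union>i<length ts. (#) i ` vertices (ts ! i))"
proof (intro set_eqI)
  fix p show "p \<in> vertices (Node ts) \<longleftrightarrow> p \<in> insert [] (\<Union>i<length ts. (#) i ` vertices (ts ! i))"
    by (cases p) (auto simp: vertices_def)
qed

lemma finite_vertices: "finite (vertices T)"
proof (induction T)
  case (Node ts)
  then have "finite (vertices (ts ! i))" if "i < length ts" for i
    using that by simp
  then show ?case
    by (auto simp: vertices_Node)
qed (simp add: vertices_Empty)

lemma card_vertices_child:
  assumes "t \<in> set ts"
  shows "card (vertices t) < card (vertices (Node ts))"
proof -
  obtain i where i: "i < length ts" "t = ts ! i"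
    using assms by (metis in_set_conv_nth)
  have "card (vertices t) = card ((#) i ` vertices t)"
    by (simp add: card_image)
  also have "\<dots> < card (vertices (Node ts))"
  proof (rule psubset_card_mono[OF finite_vertices])
    have "(#) i ` vertices t \<subseteq> vertices (Node ts)"
      using i by (auto simp: vertices_Node)
    moreover have "[] \<in> vertices (Node ts)" "[] \<notin> (#) i ` vertices t"
      by (auto simp: vertices_Node)
    ultimately show "(#) i ` vertices t \<subset> vertices (Node ts)"
      by blast
  qed
  finally show ?thesis .
qed

lemma finite_kary_trees: "finite (kary_trees k n)"
proof (induction n rule: less_induct)
  case (less n)
  let ?S = "\<Union>m<n. kary_trees k m"
  have "kary_trees k n \<subseteq> insert Empty (Node ` {ts. set ts \<subseteq> ?S \<and> length ts = k})"
  proof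
    fix T assume "T \<in> kary_trees k n"
    then have T: "is_kary k T" "card (vertices T) = n"
      by (auto simp: kary_trees_def)
    from T(1) show "T \<in> insert Empty (Node ` {ts. set ts \<subseteq> ?S \<and> length ts = k})"
    proof cases
      case (Node ts)
      then have "set ts \<subseteq> ?S"
        using T(2) card_vertices_child[of _ ts] by (auto simp: kary_trees_def)
      then show ?thesis using Node by blast
    qed simp
  qed
  moreover have "finite ?S"
    using less by simp
  then have "finite (insert Empty (Node ` {ts. set ts \<subseteq> ?S \<and> length ts = k}))"
    by (intro finite.insertI finite_imageI finite_lists_length_eq)
  ultimately show ?case
    by (rule finite_subset)
qed

end

theory Submission
  imports Defs
begin

text \<open>
  Deleting the root of a non-empty \<open>k\<close>-ary tree leaves a \<open>k\<close>-tuple of \<open>k\<close>-ary trees, and every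
  remaining vertex keeps its hook length, while the root has hook length \<open>n\<close>, the number of vertices.
  Hence the coefficients of \<open>f\<close> satisfy \<open>[x^n] f = \<rho> n * [x^(n-1)] f^k\<close>.
\<close>

text \<open>Splitting off the head, whose weight \<open>i\<close> is kept as a separate coordinate,
  gives the index set the shape of a Cauchy product.\<close>

lemma lists_of_weight_Suc:
  fixes s :: "'b \<Rightarrow> nat"
  shows "{xs. length xs = Suc k \<and> list_all P xs \<and> sum_list (map s xs) = n} =
    (\<lambda>(i, x, xs). x # xs) ` (SIGMA i:{0..n}. {x. P x \<and> s x = i} \<times>
      {xs. length xs = k \<and> list_all P xs \<and> sum_list (map s xs) = n - i})"
    (is "?L = ?h ` ?R")
proof (intro set_eqI iffI)
  fix ys assume ys: "ys \<in> ?L"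
  then obtain x xs where "ys = x # xs" by (cases ys) auto
  with ys have "ys = ?h (s x, x, xs)" "(s x, x, xs) \<in> ?R" by auto
  then show "ys \<in> ?h ` ?R" by blast
qed auto

lemma finite_lists_of_weight:
  fixes s :: "'b \<Rightarrow> nat"
  assumes "\<And>n. finite {x. P x \<and> s x = n}"
  shows "finite {xs. length xs = k \<and> list_all P xs \<and> sum_list (map s xs) = n}"
proof (induction k arbitrary: n)
  case 0
  have "{xs. length xs = 0 \<and> list_all P xs \<and> sum_list (map s xs) = n} \<subseteq> {[]}" by auto
  then show ?case by (rule finite_subset) simp
next
  case (Suc k)
  show ?case unfolding lists_of_weight_Suc
    by (intro finite_imageI finite_SigmaI finite_cartesian_product assms Suc) simp
qed

text \<open>The product rule for weighted generating functions: sizes add and weights multiply along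
  a list, so each further factor of the power contributes one more list entry. Finiteness of each
  size class is needed to expand and regroup the sums.\<close>

lemma fps_nth_power_generating_function:
  fixes s :: "'b \<Rightarrow> nat" and w :: "'b \<Rightarrow> 'a::comm_semiring_1"
  assumes fin: "\<And>n. finite {x. P x \<and> s x = n}"
  shows "fps_nth (Abs_fps (\<lambda>n. \<Sum>x | P x \<and> s x = n. w x) ^ k) n =
    (\<Sum>xs | length xs = k \<and> list_all P xs \<and> sum_list (map s xs) = n. prod_list (map w xs))"
proof (induction k arbitrary: n)
  case 0
  have "{xs. xs = [] \<and> list_all P xs \<and> sum_list (map s xs) = n} = (if n = 0 then {[]} else {})"
    by auto
  then show ?case by auto
next
  case (Suc k)
  let ?A = "\<lambda>i. {x. P x \<and> s x = i}"
  let ?B = "\<lambda>m. {xs. length xs = k \<and> list_all P xs \<and> sum_list (map s xs) = m}"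
  \<comment> \<open>The dropped coordinate \<open>i\<close> is recovered from the head as
    \<open>s x\<close>.\<close>
  have inj: "inj_on (\<lambda>(i, x, xs). x # xs) (SIGMA i:{0..n}. ?A i \<times> ?B (n - i))"
    by (auto simp: inj_on_def)
  have "fps_nth (Abs_fps (\<lambda>n. \<Sum>x\<in>?A n. w x) ^ Suc k) n =
      (\<Sum>i=0..n. (\<Sum>x\<in>?A i. w x) * (\<Sum>xs\<in>?B (n - i). prod_list (map w xs)))"
    by (simp add: fps_mult_nth Suc)
  also have "\<dots> = (\<Sum>i=0..n. \<Sum>(x, xs)\<in>?A i \<times> ?B (n - i). prod_list (map w (x # xs)))"
    by (simp add: sum_product sum.cartesian_product)
  also have "\<dots> = (\<Sum>(i, x, xs)\<in>(SIGMA i:{0..n}. ?A i \<times> ?B (n - i)). prod_list (map w (x # xs)))"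
    by (subst sum.Sigma) (auto intro!: finite_cartesian_product fin finite_lists_of_weight[OF fin])
  also have "\<dots> = (\<Sum>xs | length xs = Suc k \<and> list_all P xs \<and> sum_list (map s xs) = n.
      prod_list (map w xs))"
    unfolding lists_of_weight_Suc
    by (subst sum.reindex[OF inj]) (auto intro!: sum.cong)
  finally show ?case .
qed

text \<open>The address \<open>[]\<close> is the root, and addresses with different first entries
  lie in different subtrees, so the union is disjoint.\<close>

lemma prod_vertices_Node:
  fixes g :: "nat list \<Rightarrow> 'a::comm_monoid_mult"
  shows "prod g (vertices (Node ts)) = g [] * (\<Prod>i<length ts. \<Prod>p\<in>vertices (ts ! i). g (i # p))"
proof -
  have "prod g (vertices (Node ts)) = g [] * prod g (\<Union>i<length ts. (#) i ` vertices (ts ! i))"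
    unfolding vertices_Node by (subst prod.insert) (auto simp: finite_vertices)
  also have "prod g (\<Union>i<length ts. (#) i ` vertices (ts ! i)) =
      (\<Prod>i<length ts. prod g ((#) i ` vertices (ts ! i)))"
    by (intro prod.UNION_disjoint) (auto simp: finite_vertices)
  also have "\<dots> = (\<Prod>i<length ts. \<Prod>p\<in>vertices (ts ! i). g (i # p))"
    by (simp add: prod.reindex)
  finally show ?thesis .
qed

lemma card_vertices_Node:
  "card (vertices (Node ts)) = Suc (\<Sum>t\<leftarrow>ts. card (vertices t))"
proof -
  have "card (vertices (Node ts)) = Suc (card (\<Union>i<length ts. (#) i ` vertices (ts ! i)))"
    unfolding vertices_Node by (subst card_insert_disjoint) (auto simp: finite_vertices)
  also have "card (\<Union>i<length ts. (#) i ` vertices (ts ! i)) =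
      (\<Sum>i<length ts. card ((#) i ` vertices (ts ! i)))"
    by (intro card_UN_disjoint) (auto simp: finite_vertices)
  also have "\<dots> = (\<Sum>t\<leftarrow>ts. card (vertices t))"
    by (simp add: card_image sum.list_conv_set_nth atLeast0LessThan)
  finally show ?thesis .
qed

lemma hook_length_Nil: "hook_length T [] = card (vertices T)"
  by (simp add: hook_length_def)

text \<open>Prepending \<open>i\<close> is injective and maps the descendants of \<open>p\<close> in
  the subtree onto those of \<open>i # p\<close> in the whole tree.\<close>

lemma hook_length_Cons:
  assumes "i < length ts"
  shows "hook_length (Node ts) (i # p) = hook_length (ts ! i) p"
proof -
  have "{v \<in> vertices (Node ts). prefix (i # p) v} = (#) i ` {v \<in> vertices (ts ! i). prefix p v}"
    using assms by (auto simp: vertices_Node)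
  then show ?thesis by (simp add: hook_length_def card_image)
qed

lemma prod_hooks:
  "(\<Prod>h\<in>#hooks T. \<rho> h) = (\<Prod>u\<in>vertices T. \<rho> (hook_length T u))"
  by (simp add: hooks_def prod_unfold_prod_mset image_mset.compositionality o_def)

lemma prod_hooks_Node:
  "(\<Prod>h\<in>#hooks (Node ts). \<rho> h) =
    \<rho> (card (vertices (Node ts))) * (\<Prod>t\<leftarrow>ts. \<Prod>h\<in>#hooks t. \<rho> h)"
  by (simp add: prod_hooks prod_vertices_Node hook_length_Nil hook_length_Cons
      prod.list_conv_set_nth atLeast0LessThan)

lemma kary_trees_0: "kary_trees k 0 = {Empty}"
proof -
  have "T = Empty" if "card (vertices T) = 0" for T
    using that by (cases T) (auto simp: card_vertices_Node)
  then show ?thesis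
    by (auto simp: kary_trees_def vertices_Empty intro: is_kary.Empty)
qed

text \<open>The set of lists has the form used in \<open>fps_nth_power_generating_function\<close>,
  with \<open>is_kary k\<close> as the predicate and the number of vertices as the size.\<close>

lemma kary_trees_Suc:
  "kary_trees k (Suc n) =
    Node ` {ts. length ts = k \<and> list_all (is_kary k) ts \<and> (\<Sum>t\<leftarrow>ts. card (vertices t)) = n}"
proof (intro set_eqI iffI)
  fix T assume "T \<in> kary_trees k (Suc n)"
  then have "is_kary k T" and card: "card (vertices T) = Suc n"
    by (auto simp: kary_trees_def)
  then show "T \<in> Node ` {ts. length ts = k \<and> list_all (is_kary k) ts \<and>
      (\<Sum>t\<leftarrow>ts. card (vertices t)) = n}"
    by cases (auto simp: vertices_Empty card_vertices_Node list_all_iff)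
qed (auto simp: kary_trees_def card_vertices_Node list_all_iff intro: is_kary.Node)

theorem theorem2p1:
  fixes k :: nat and \<rho> :: "nat \<Rightarrow> 'a::field" and f :: "'a fps"
  assumes "k \<ge> 1"
    and "1 + Abs_fps (\<lambda>n. if n \<ge> 1
               then (\<Sum>T\<in>kary_trees k n. \<Prod>h\<in>#hooks T. \<rho> h) else 0) = f"
  shows "\<forall>n\<ge>1. fps_nth (f ^ k) (n - 1) \<noteq> 0 \<longrightarrow>
           \<rho> n = fps_nth f n / fps_nth (f ^ k) (n - 1)"
proof (intro allI impI)
  fix n :: nat assume n: "n \<ge> 1" and nz: "fps_nth (f ^ k) (n - 1) \<noteq> 0"
  then obtain m where m: "n = Suc m" by (cases n) auto
  let ?w = "\<lambda>T. \<Prod>h\<in>#hooks T. \<rho> h"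
  let ?B = "{ts. length ts = k \<and> list_all (is_kary k) ts \<and> (\<Sum>t\<leftarrow>ts. card (vertices t)) = m}"
  \<comment> \<open>The separate summand 1 is the term for \<open>n = 0\<close>: the only tree there
    is \<open>Empty\<close>, whose hook product is empty.\<close>
  have f: "f = Abs_fps (\<lambda>n. \<Sum>T | is_kary k T \<and> card (vertices T) = n. ?w T)"
    unfolding assms(2)[symmetric] kary_trees_def[symmetric]
    by (rule fps_ext) (auto simp: not_le kary_trees_0 prod_hooks vertices_Empty)
  have "fps_nth f n = (\<Sum>T\<in>kary_trees k (Suc m). ?w T)"
    by (simp add: f m kary_trees_def)
  also have "\<dots> = (\<Sum>ts\<in>?B. ?w (Node ts))"
    unfolding kary_trees_Suc by (subst sum.reindex) (auto simp: inj_on_def)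
  \<comment> \<open>Every tree in the sum has \<open>n\<close> vertices, so its root contributes the
    same factor \<open>\<rho> n\<close>, which can leave the sum.\<close>
  also have "\<dots> = (\<Sum>ts\<in>?B. \<rho> n * (\<Prod>t\<leftarrow>ts. ?w t))"
    by (rule sum.cong) (auto simp: prod_hooks_Node card_vertices_Node m)
  also have "\<dots> = \<rho> n * fps_nth (f ^ k) m"
    unfolding f using finite_kary_trees[of k]
    by (subst fps_nth_power_generating_function) (simp_all add: kary_trees_def sum_distrib_left)
  finally show "\<rho> n = fps_nth f n / fps_nth (f ^ k) (n - 1)"
    using nz by (simp add: m)
qed

end
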